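(* Let $T(u)=ab'+a'b-b^2-(b')^2$ for $u=(a,b,b',a')\in\mathbb{U}^4$. Let $q$ be any invariant metric on $\mathbb{U}^4$, with unit ball $B(1,q)=\{u\in\mathbb{U}^4 : q(u)\le 1\}$. Let $V_-$ be the volume of the part $C_-$ of $B(1,q)$ where $T$ is negative, and let $V_+$ be the volume of the part $C_+$ of $B(1,q)$ where $T$ is positive, volumes being taken with respect to the Euclidean metric $q$. Then $$\frac{V_-}{V_+}=9\,(\sigma(q))^2,$$ where $\sigma(q)$ is the asymmetry of $q$.
   Context: $\mathbb{U}^4$ is the space $\mathbb{R}^4$ of row vectors $u=(a,b,b',a')$, identified with the real cubic forms $\frac16(ax^3+3bx^2y+3b'xy^2+a'y^3)$, endowed with the right linear action of the group of rotations of the plane (denoted $\mathbb{O}(2)$ in the paper): the rotation by angle $\theta$ sends the cubic form $u$ to the cubic form $U=(A,B,B',A')$ in $X,Y$ obtained by substituting $x=\cos\theta\,X-\sin\theta\,Y$, $y=\sin\theta\,X+\cos\theta\,Y$. This is $U=u\,\Omega(\theta)$ with $$\Omega(\theta)=\begin{pmatrix}\cos^3\theta & -\sin\theta\cos^2\theta & \sin^2\theta\cos\theta & -\sin^3\theta\\ 3\cos^2\theta\sin\theta & \cos\theta(3\cos^2\theta-2) & -\sin\theta(2-3\sin^2\theta) & 3\cos\theta\sin^2\theta\\ 3\sin^2\theta\cos\theta & -\sin\theta(3\sin^2\theta-2) & \cos\theta(3\cos^2\theta-2) & -3\cos^2\theta\sin\theta\\ \sin^3\theta & \sin^2\theta\cos\theta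 & \cos^2\theta\sin\theta & \cos^3\theta\end{pmatrix}.$$ An (invariant) metric on $\mathbb{U}^4$ is a positive definite quadratic form $q(u)=uQu^{*}$, with $Q$ a positive definite real symmetric $4\times4$ matrix and $*$ denoting transpose, that is invariant under the action: $Q=\Omega(\theta)Q\Omega(\theta)^{*}$ for all $\theta$. Let $\mathbb{U}_1=\{a=3b',\ a'=3b\}$ and $\mathbb{U}_2=\{a=-b',\ a'=-b\}$ (planes in $\mathbb{U}^4$), and let $$r_1=\left(\frac{a+b'}{8}\right)^2+\left(\frac{a'+b}{8}\right)^2,\qquad r_2=\left(\frac{a-3b'}{24}\right)^2+\left(\frac{a'-3b}{24}\right)^2.$$ For an invariant metric $q$, there are uniquely determined positive constants $m_1,m_2$ such that $q_i:=r_i/m_i^2$ agrees with $q$ on $\mathbb{U}_i$, for $i=1,2$. The asymmetry of $q$ is $\sigma(q)=m_2/m_1$. *)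

theory Defs
  imports "HOL-Analysis.Analysis"
begin

text \<open>
  The cubic form \<open>(a x\<^sup>3 + 3 b x\<^sup>2 y + 3 b' x y\<^sup>2 + a' y\<^sup>3) / 6\<close> is encoded by the row vector
  \<open>u = (a, b, b', a')\<close>, so that \<open>u $ 1 = a\<close>, \<open>u $ 2 = b\<close>, \<open>u $ 3 = b'\<close>, \<open>u $ 4 = a'\<close>.
\<close>

definition cubic_form :: "real^4 \<Rightarrow> real \<Rightarrow> real \<Rightarrow> real" where
  "cubic_form u x y =
     (u $ 1 * x^3 + 3 * u $ 2 * x^2 * y + 3 * u $ 3 * x * y^2 + u $ 4 * y^3) / 6"

definition Omega :: "real \<Rightarrow> real^4^4" where
  "Omega \<theta> = (let c = cos \<theta>; s = sin \<theta> in
     vector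
      [vector [c^3,         - s * c^2,           s^2 * c,             - (s^3)],
       vector [3 * c^2 * s, c * (3 * c^2 - 2),   - s * (2 - 3 * s^2), 3 * c * s^2],
       vector [3 * s^2 * c, - s * (3 * s^2 - 2), c * (3 * c^2 - 2),   - 3 * c^2 * s],
       vector [s^3,         s^2 * c,             c^2 * s,             c^3]])"

lemma vector_4:
  "(vector [x, y, z, w] :: 'a::zero^4) $ 1 = x"
  "(vector [x, y, z, w] :: 'a::zero^4) $ 2 = y"
  "(vector [x, y, z, w] :: 'a::zero^4) $ 3 = z"
  "(vector [x, y, z, w] :: 'a::zero^4) $ 4 = w"
  unfolding vector_def by simp_all

text \<open>Sanity check: the matrix does represent the substitution of a rotation in the cubic form.\<close>

lemma cubic_form_Omega:
  "cubic_form (u v* Omega \<theta>) X Y =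
   cubic_form u (cos \<theta> * X - sin \<theta> * Y) (sin \<theta> * X + cos \<theta> * Y)"
proof -
  define c s where cs: "c = cos \<theta>" "s = sin \<theta>"
  have sc: "s^2 = 1 - c^2"
    unfolding cs by (simp add: sin_squared_eq)
  have 1: "c * (3 * c^2 - 2) = c^3 - 2 * c * s^2"
    unfolding sc by (simp add: algebra_simps power2_eq_square power3_eq_cube)
  have c2: "c^2 = 1 - s^2" using sc by simp
  have 2: "- s * (2 - 3 * s^2) = s^3 - 2 * c^2 * s"
    unfolding c2 by (simp add: algebra_simps power2_eq_square power3_eq_cube)
  have 3: "- s * (3 * s^2 - 2) = 2 * c^2 * s - s^3"
    unfolding c2 by (simp add: algebra_simps power2_eq_square power3_eq_cube)
  show ?thesis
    unfolding cubic_form_def Omega_def Let_def cs [symmetric] vector_matrix_mult_def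
    unfolding 1 2 3
    by (simp add: sum_4 vector_4) (simp add: algebra_simps power2_eq_square power3_eq_cube)
qed

definition quadratic_form :: "real^4^4 \<Rightarrow> real^4 \<Rightarrow> real" where
  "quadratic_form Q u = (u v* Q) \<bullet> u"

definition positive_definite :: "real^4^4 \<Rightarrow> bool" where
  "positive_definite Q \<longleftrightarrow> transpose Q = Q \<and> (\<forall>u. u \<noteq> 0 \<longrightarrow> quadratic_form Q u > 0)"

text \<open>A metric \<open>q(u) = u Q u\<^sup>*\<close> is given by its matrix \<open>Q\<close>, which is determined by \<open>q\<close>.\<close>

definition invariant_metric :: "real^4^4 \<Rightarrow> bool" where
  "invariant_metric Q \<longleftrightarrow>
     positive_definite Q \<and> (\<forall>\<theta>. Q = Omega \<theta> ** Q ** transpose (Omega \<theta>))"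

definition U1 :: "(real^4) set" where
  "U1 = {u. u $ 1 = 3 * u $ 3 \<and> u $ 4 = 3 * u $ 2}"

definition U2 :: "(real^4) set" where
  "U2 = {u. u $ 1 = - u $ 3 \<and> u $ 4 = - u $ 2}"

definition r1 :: "real^4 \<Rightarrow> real" where
  "r1 u = ((u $ 1 + u $ 3) / 8)^2 + ((u $ 4 + u $ 2) / 8)^2"

definition r2 :: "real^4 \<Rightarrow> real" where
  "r2 u = ((u $ 1 - 3 * u $ 3) / 24)^2 + ((u $ 4 - 3 * u $ 2) / 24)^2"

definition m1 :: "(real^4 \<Rightarrow> real) \<Rightarrow> real" where
  "m1 q = (THE m. m > 0 \<and> (\<forall>u\<in>U1. r1 u / m^2 = q u))"

definition m2 :: "(real^4 \<Rightarrow> real) \<Rightarrow> real" where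
  "m2 q = (THE m. m > 0 \<and> (\<forall>u\<in>U2. r2 u / m^2 = q u))"

definition asymmetry :: "(real^4 \<Rightarrow> real) \<Rightarrow> real" where
  "asymmetry q = m2 q / m1 q"

definition T :: "real^4 \<Rightarrow> real" where
  "T u = u $ 1 * u $ 3 + u $ 4 * u $ 2 - (u $ 2)^2 - (u $ 3)^2"

definition unit_ball :: "(real^4 \<Rightarrow> real) \<Rightarrow> (real^4) set" where
  "unit_ball q = {u. q u \<le> 1}"

text \<open>
  The volume for the Euclidean metric with Gram matrix \<open>Q\<close> in the standard basis: the multiple
  of Lebesgue measure for which a \<open>Q\<close>-orthonormal basis spans a parallelepiped of volume 1.
\<close>

definition metric_volume :: "real^4^4 \<Rightarrow> (real^4) set \<Rightarrow> real" where
  "metric_volume Q S = sqrt (det Q) * measure lborel S"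

end

theory Submission
  imports Defs
begin

text \<open>
  The space of cubic forms is the sum of two planes, the products of \<open>x\<^sup>2 + y\<^sup>2\<close> with linear forms and
  the harmonic cubic forms. Rotations of the variables act on these planes by the angles \<open>\<theta>\<close> and
  \<open>3 \<theta>\<close>. As these representations are inequivalent, every invariant metric has the form
  \<open>\<alpha> \<bar>v\<bar>\<^sup>2 + \<beta> \<bar>w\<bar>\<^sup>2\<close> in suitable coordinate vectors \<open>v\<close>, \<open>w\<close> of the two planes
  (\<open>invariant_metric_components\<close>); in the same coordinates \<open>T\<close> is \<open>2 (\<bar>v\<bar>\<^sup>2 - \<bar>w\<bar>\<^sup>2)\<close>
  (\<open>T_of_components\<close>). Both the unit ball and the sign of \<open>T\<close> thus depend on the squared norms
  \<open>r = \<bar>v\<bar>\<^sup>2\<close> and \<open>s = \<bar>w\<bar>\<^sup>2\<close> only.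

  The area of a disc is proportional to its squared radius, so the squared norm carries
  Lebesgue measure of the plane to \<open>\<pi>\<close> times Lebesgue measure of the half-line
  (\<open>distr_norm_square_plane\<close>). Up to a common factor the volumes in question are therefore the areas
  of the two parts into which the diagonal \<open>r = s\<close> divides the triangle \<open>\<alpha> r + \<beta> s \<le> 1\<close> of the
  positive quadrant. These triangles share the side on the diagonal, and their other sides at
  the origin are \<open>1 / \<beta>\<close> (where \<open>r < s\<close>, that is \<open>T < 0\<close>) and \<open>1 / \<alpha>\<close> (where \<open>T > 0\<close>); so the ratio
  of the volumes is \<open>\<alpha> / \<beta>\<close> (\<open>measure_two_planes_compare\<close>). The normalizations of \<open>r\<^sub>1\<close> and \<open>r\<^sub>2\<close>
  turn this into \<open>9 \<sigma>\<^sup>2\<close> (\<open>asymmetry_square\<close>).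
\<close>

section \<open>The areas swept out by discs\<close>

definition disc_area :: "real measure" where
  "disc_area = density lborel (\<lambda>r. ennreal (pi * indicator {0..} r))"

lemma sets_disc_area [simp, measurable_cong]: "sets disc_area = sets borel"
  by (simp add: disc_area_def)

lemma space_disc_area [simp]: "space disc_area = UNIV"
  by (simp add: disc_area_def)

lemma emeasure_disc_area_Ioc:
  assumes "0 \<le> a"
  shows "emeasure disc_area {a<..b} = ennreal (pi * max 0 (b - a))"
proof -
  have "emeasure disc_area {a<..b} = (\<integral>\<^sup>+r. ennreal pi * indicator {a<..b} r \<partial>lborel)"
    unfolding disc_area_def using assms
    by (subst emeasure_density) (auto intro!: nn_integral_cong simp: indicator_def)
  also have "\<dots> = ennreal (pi * max 0 (b - a))"
    by (cases "a \<le> b") (auto simp: nn_integral_cmult ennreal_mult)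
  finally show ?thesis .
qed

lemma emeasure_disc_area_atMost:
  "emeasure disc_area {..b} = ennreal (pi * max 0 b)"
proof -
  have "emeasure disc_area {..b} = (\<integral>\<^sup>+r. ennreal pi * indicator {0..b} r \<partial>lborel)"
    unfolding disc_area_def
    by (subst emeasure_density) (auto intro!: nn_integral_cong simp: indicator_def)
  also have "\<dots> = ennreal (pi * max 0 b)"
    by (cases "0 \<le> b") (auto simp: nn_integral_cmult ennreal_mult)
  finally show ?thesis .
qed

lemma norm_square_le_iff:
  assumes "0 \<le> b"
  shows "(norm v)\<^sup>2 \<le> b \<longleftrightarrow> norm v \<le> sqrt b"
  using assms sqrt_ge_absD [of "norm v" b] real_le_rsqrt [of "norm v" b] by auto

lemma nn_integral_disc_area:
  assumes [measurable]: "f \<in> borel_measurable borel"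
  shows "(\<integral>\<^sup>+r. f r \<partial>disc_area) = (\<integral>\<^sup>+r. ennreal (pi * indicator {0..} r) * f r \<partial>lborel)"
  unfolding disc_area_def by (subst nn_integral_density) auto

text \<open>
  A disc of squared radius \<open>r\<close> has area \<open>\<pi> r\<close>, which is linear in \<open>r\<close>. Therefore the squared norm of a
  point of the plane is uniformly distributed on the half-line, with density \<open>\<pi>\<close>.
\<close>

lemma distr_norm_square_plane:
  "distr (lborel :: (real \<times> real) measure) borel (\<lambda>v. (norm v)\<^sup>2) = disc_area"
proof (rule measure_eqI_generator_eq [where \<Omega>=UNIV and E="range (\<lambda>b::real. {..b})" and A="\<lambda>n. {..real n}"])
  show "Int_stable (range (\<lambda>b::real. {..b}))"
    by (auto simp: Int_stable_def)
  fix X assume "X \<in> range (\<lambda>b::real. {..b})"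
  then obtain b where X: "X = {..b}" by auto
  have pre: "(\<lambda>v::real \<times> real. (norm v)\<^sup>2) -` {..b} = (if 0 \<le> b then cball 0 (sqrt b) else {})"
    by (auto simp: norm_square_le_iff dest: order_trans [OF zero_le_power2])
  show "emeasure (distr (lborel :: (real \<times> real) measure) borel (\<lambda>v. (norm v)\<^sup>2)) X = emeasure disc_area X"
    unfolding X emeasure_disc_area_atMost
    by (subst emeasure_distr) (auto simp: pre emeasure_cball unit_ball_vol_2 mult.commute)
next
  show "(\<Union>i. {..real i}) = UNIV" using real_arch_simple by auto
next
  fix i show "emeasure (distr (lborel :: (real \<times> real) measure) borel (\<lambda>v. (norm v)\<^sup>2)) {..real i} \<noteq> \<infinity>"
  proof -
    have pre: "(\<lambda>v::real \<times> real. (norm v)\<^sup>2) -` {..real i} = cball 0 (sqrt i)"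
      by (auto simp: norm_square_le_iff)
    show ?thesis
      by (subst emeasure_distr) (auto simp: pre emeasure_cball)
  qed
qed (auto simp: borel_eq_atMost)

lemma sigma_finite_disc_area: "sigma_finite_measure disc_area"
  unfolding disc_area_def
  by (subst sigma_finite_measure.sigma_finite_iff_density_finite [OF sigma_finite_lborel])
     (auto simp: indicator_def)

text \<open>
  Up to the factor \<open>\<pi>\<^sup>2\<close> this is the area of the triangle cut out of the positive quadrant by
  \<open>r < s\<close> and \<open>\<alpha> r + \<beta> s \<le> 1\<close>. Its vertices are \<open>(0, 0)\<close>, \<open>(0, 1 / \<beta>)\<close> and the point with both
  coordinates \<open>1 / (\<alpha> + \<beta>)\<close>.
\<close>

lemma emeasure_disc_area_triangle:
  assumes "0 < \<alpha>" "0 < \<beta>"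
  shows "(\<integral>\<^sup>+r. emeasure disc_area {s. \<alpha> * r + \<beta> * s \<le> 1 \<and> r < s} \<partial>disc_area)
    = ennreal (pi\<^sup>2 / (2 * \<beta> * (\<alpha> + \<beta>)))"
proof -
  \<comment> \<open>For \<open>r > c\<close> the line \<open>\<alpha> r + \<beta> s = 1\<close> lies below the diagonal and the slice is empty.\<close>
  define c where "c = 1 / (\<alpha> + \<beta>)"
  have c: "0 < c" using assms by (simp add: c_def)
  have "(\<integral>\<^sup>+r. emeasure disc_area {s. \<alpha> * r + \<beta> * s \<le> 1 \<and> r < s} \<partial>disc_area)
     = (\<integral>\<^sup>+r. ennreal (pi * indicator {0..} r) * emeasure disc_area {r<..(1 - \<alpha> * r) / \<beta>} \<partial>lborel)"
  proof -
    have *: "{s. \<alpha> * r + \<beta> * s \<le> 1 \<and> r < s} = {r<..(1 - \<alpha> * r) / \<beta>}" for r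
      using assms by (auto simp: field_simps)
    have [measurable]: "(\<lambda>r. emeasure disc_area {r<..(1 - \<alpha> * r) / \<beta>}) \<in> borel_measurable borel"
    proof -
      let ?S = "{p :: real \<times> real. fst p < snd p \<and> snd p \<le> (1 - \<alpha> * fst p) / \<beta>}"
      have "{p \<in> space (borel \<Otimes>\<^sub>M borel). fst p < snd p \<and> snd p \<le> (1 - \<alpha> * fst p) / \<beta>}
          \<in> sets (borel \<Otimes>\<^sub>M borel)"
        by measurable
      then have "?S \<in> sets (borel \<Otimes>\<^sub>M disc_area)"
        by (simp add: space_pair_measure cong: sets_pair_measure_cong)
      from sigma_finite_measure.measurable_emeasure_Pair [OF sigma_finite_disc_area this]
      have "(\<lambda>r. emeasure disc_area (Pair r -` ?S)) \<in> borel_measurable borel" .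
      moreover have "Pair r -` ?S = {r<..(1 - \<alpha> * r) / \<beta>}" for r
        by auto
      ultimately show ?thesis by simp
    qed
    show ?thesis unfolding * by (rule nn_integral_disc_area) simp
  qed
  also have "\<dots> = (\<integral>\<^sup>+r. ennreal (pi\<^sup>2 * (1 - (\<alpha> + \<beta>) * r) / \<beta>) * indicator {0..c} r \<partial>lborel)"
  proof (rule nn_integral_cong)
    fix r :: real
    have *: "max 0 ((1 - \<alpha> * r) / \<beta> - r) = (if r \<le> c then (1 - (\<alpha> + \<beta>) * r) / \<beta> else 0)"
      using assms by (auto simp: c_def field_simps max_def)
    have "0 \<le> (1 - (\<alpha> + \<beta>) * r) / \<beta>" if "r \<le> c" using that assms by (auto simp: c_def field_simps)
    then show "ennreal (pi * indicator {0..} r) * emeasure disc_area {r<..(1 - \<alpha> * r) / \<beta>}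
      = ennreal (pi\<^sup>2 * (1 - (\<alpha> + \<beta>) * r) / \<beta>) * indicator {0..c} r"
      by (cases "0 \<le> r") (auto simp: emeasure_disc_area_Ioc * indicator_def power2_eq_square mult.assoc simp flip: ennreal_mult)
  qed
  also have "\<dots> = ennreal (pi\<^sup>2 / (2 * \<beta> * (\<alpha> + \<beta>)))"
  proof -
    let ?F = "\<lambda>r. pi\<^sup>2 * (r - (\<alpha> + \<beta>) * r\<^sup>2 / 2) / \<beta>"
    have "(\<integral>\<^sup>+r. ennreal (pi\<^sup>2 * (1 - (\<alpha> + \<beta>) * r) / \<beta>) * indicator {0..c} r \<partial>lborel) = ennreal (?F c - ?F 0)"
    proof (rule nn_integral_FTC_Icc)
      fix r assume r: "r \<in> {0..c}"
      show "DERIV ?F r :> pi\<^sup>2 * (1 - (\<alpha> + \<beta>) * r) / \<beta>"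
        using assms by (auto intro!: derivative_eq_intros)
      have "(\<alpha> + \<beta>) * r \<le> 1"
        using r assms by (simp add: c_def field_simps)
      then show "0 \<le> pi\<^sup>2 * (1 - (\<alpha> + \<beta>) * r) / \<beta>"
        using assms by simp
    qed (use c in auto)
    also have "?F c - ?F 0 = pi\<^sup>2 / (2 * \<beta> * (\<alpha> + \<beta>))"
    proof -
      have "(\<alpha> + \<beta>) * c = 1" using assms by (simp add: c_def)
      then have "c - (\<alpha> + \<beta>) * c\<^sup>2 / 2 = c / 2"
        by (simp add: power2_eq_square flip: mult.assoc)
      then show ?thesis by (simp add: c_def)
    qed
    finally show ?thesis .
  qed
  finally show ?thesis .
qed

section \<open>Volumes in a product of two planes\<close>

definition join_planes :: "(real \<times> real) \<times> (real \<times> real) \<Rightarrow> real^4" where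
  "join_planes = (\<lambda>((x1, x2), (y1, y2)). vector [x1, x2, y1, y2])"

lemma forall_4: "(\<forall>i::4. P i) \<longleftrightarrow> P 1 \<and> P 2 \<and> P 3 \<and> P 4"
  by (metis exhaust_4)

lemma prod_UNIV_4: "(\<Prod>i\<in>UNIV. f (i :: 4)) = f 1 * f 2 * f 3 * f 4"
  unfolding UNIV_4 by (simp add: mult.assoc)

lemma vec_eq_4: "(u :: 'a^4) = v \<longleftrightarrow> u $ 1 = v $ 1 \<and> u $ 2 = v $ 2 \<and> u $ 3 = v $ 3 \<and> u $ 4 = v $ 4"
  by (simp add: vec_eq_iff forall_4)

lemma join_planes_nth:
  "join_planes w $ 1 = fst (fst w)" "join_planes w $ 2 = snd (fst w)"
  "join_planes w $ 3 = fst (snd w)" "join_planes w $ 4 = snd (snd w)"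
  by (simp_all add: join_planes_def vector_4 split: prod.split)

lemma join_planes_measurable [measurable]: "join_planes \<in> borel_measurable borel"
proof (rule borel_measurable_continuous_onI)
  have "continuous_on UNIV (\<lambda>w. join_planes w $ i)" for i
    using exhaust_4 [of i]
    by (elim disjE; simp only: join_planes_nth; intro continuous_intros)
  then have "continuous_on UNIV (\<lambda>w. \<chi> i. join_planes w $ i)"
    by (rule continuous_on_vec_lambda)
  then show "continuous_on UNIV join_planes" by (simp only: vec_nth_inverse eta_contract_eq vec_lambda_eta)
qed

lemma distr_join_planes:
  "distr lborel borel join_planes = lborel"
proof (rule lborel_eqI [symmetric])
  fix l u :: "real^4"
  assume lu: "\<And>b. b \<in> Basis \<Longrightarrow> l \<bullet> b \<le> u \<bullet> b"
  have le: "l $ i \<le> u $ i" for i using lu[of "axis i 1"]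
    by (simp add: inner_axis axis_in_Basis_iff)
  have "join_planes -` box l u = ({l$1<..<u$1} \<times> {l$2<..<u$2}) \<times> ({l$3<..<u$3} \<times> {l$4<..<u$4})"
    by (auto simp: mem_box_cart forall_4 join_planes_nth)
  then have "emeasure (distr lborel borel join_planes) (box l u) =
      emeasure ((lborel \<Otimes>\<^sub>M lborel) \<Otimes>\<^sub>M (lborel \<Otimes>\<^sub>M lborel))
        (({l$1<..<u$1} \<times> {l$2<..<u$2}) \<times> ({l$3<..<u$3} \<times> {l$4<..<u$4}))"
    by (subst emeasure_distr) (simp_all add: lborel_prod)
  also have "\<dots> = ennreal ((u$1 - l$1) * (u$2 - l$2) * ((u$3 - l$3) * (u$4 - l$4)))"
  proof -
    have pair: "emeasure (lborel \<Otimes>\<^sub>M lborel) ({a<..<b} \<times> {c<..<d}) = ennreal ((b - a) * (d - c))"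
      if "a \<le> b" "c \<le> d" for a b c d :: real
      using that by (simp add: lborel.emeasure_pair_measure_Times ennreal_mult del: lborel_prod)
    have plane: "sigma_finite_measure (lborel \<Otimes>\<^sub>M lborel :: (real \<times> real) measure)"
      unfolding lborel_prod by (rule sigma_finite_lborel)
    show ?thesis
      using le by (subst sigma_finite_measure.emeasure_pair_measure_Times [OF plane]) (simp_all add: pair ennreal_mult del: lborel_prod)
  qed
  also have "(u$1 - l$1) * (u$2 - l$2) * ((u$3 - l$3) * (u$4 - l$4)) = (\<Prod>i\<in>UNIV. u $ i - l $ i)"
    by (simp only: prod_UNIV_4 mult.assoc)
  also have "\<dots> = (\<Prod>b\<in>range (\<lambda>i :: 4. axis i 1). (u - l) \<bullet> b)"
    by (subst prod.reindex) (auto simp: inj_on_def axis_eq_axis inner_axis)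
  also have "range (\<lambda>i :: 4. axis i (1 :: real)) = Basis"
    by (auto simp: Basis_vec_def)
  finally show "emeasure (distr lborel borel join_planes) (box l u) = (\<Prod>b\<in>Basis. (u - l) \<bullet> b)" .
qed simp

text \<open>
  A set of pairs of plane vectors that is described by the two squared norms alone has the same
  volume as its image under the squared norms: both factors are pushed forward separately.
\<close>

lemma emeasure_two_planes:
  assumes E [measurable]: "E \<in> sets (borel \<Otimes>\<^sub>M borel)"
  shows "emeasure lborel {v :: real^4. ((v $ 1)\<^sup>2 + (v $ 2)\<^sup>2, (v $ 3)\<^sup>2 + (v $ 4)\<^sup>2) \<in> E}
    = emeasure (disc_area \<Otimes>\<^sub>M disc_area) E"
proof -
  let ?n = "\<lambda>v :: real \<times> real. (norm v)\<^sup>2"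
  have "disc_area \<Otimes>\<^sub>M disc_area = distr (lborel \<Otimes>\<^sub>M lborel) (borel \<Otimes>\<^sub>M borel) (\<lambda>(x, y). (?n x, ?n y))"
    using pair_measure_distr [of ?n lborel borel ?n lborel borel]
    by (simp add: distr_norm_square_plane sigma_finite_disc_area)
  then have "emeasure (disc_area \<Otimes>\<^sub>M disc_area) E
      = emeasure (lborel \<Otimes>\<^sub>M lborel) ((\<lambda>(x, y). (?n x, ?n y)) -` E)"
    by (simp add: emeasure_distr space_pair_measure)
  also have "(\<lambda>(x, y). (?n x, ?n y)) -` E
      = join_planes -` {v. ((v $ 1)\<^sup>2 + (v $ 2)\<^sup>2, (v $ 3)\<^sup>2 + (v $ 4)\<^sup>2) \<in> E}"
    by (auto simp: join_planes_nth norm_Pair)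
  also have "emeasure (lborel \<Otimes>\<^sub>M lborel) \<dots>
      = emeasure (distr lborel borel join_planes) {v. ((v $ 1)\<^sup>2 + (v $ 2)\<^sup>2, (v $ 3)\<^sup>2 + (v $ 4)\<^sup>2) \<in> E}"
  proof (subst emeasure_distr)
    show "{v :: real^4. ((v $ 1)\<^sup>2 + (v $ 2)\<^sup>2, (v $ 3)\<^sup>2 + (v $ 4)\<^sup>2) \<in> E} \<in> sets borel"
      by measurable
  qed (simp_all add: lborel_prod)
  finally show ?thesis by (simp add: distr_join_planes)
qed

text \<open>
  The solid ellipsoid becomes a triangle in the quadrant of squared norms, and the cone on which
  the two norms are equal becomes the diagonal. It divides the triangle into two parts, which are
  exchanged when the two coordinates and \<open>\<alpha>\<close>, \<open>\<beta>\<close> are swapped; slicing the second part along the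
  other coordinate thus reduces it to the first.
\<close>

lemma measure_two_planes_compare:
  assumes "0 < \<alpha>" "0 < \<beta>"
  defines "D \<equiv> {v :: real^4. \<alpha> * ((v $ 1)\<^sup>2 + (v $ 2)\<^sup>2) + \<beta> * ((v $ 3)\<^sup>2 + (v $ 4)\<^sup>2) \<le> 1}"
  shows "measure lborel {v \<in> D. (v $ 1)\<^sup>2 + (v $ 2)\<^sup>2 < (v $ 3)\<^sup>2 + (v $ 4)\<^sup>2} = pi\<^sup>2 / (2 * \<beta> * (\<alpha> + \<beta>))"
    and "measure lborel {v \<in> D. (v $ 3)\<^sup>2 + (v $ 4)\<^sup>2 < (v $ 1)\<^sup>2 + (v $ 2)\<^sup>2} = pi\<^sup>2 / (2 * \<alpha> * (\<alpha> + \<beta>))"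
proof -
  interpret disc_area: sigma_finite_measure disc_area by (rule sigma_finite_disc_area)
  interpret pair: pair_sigma_finite disc_area disc_area ..
  have sets: "{p \<in> space (borel \<Otimes>\<^sub>M borel). \<alpha> * fst p + \<beta> * snd p \<le> 1 \<and> fst p < snd p} \<in> sets (borel \<Otimes>\<^sub>M borel)"
    "{p \<in> space (borel \<Otimes>\<^sub>M borel). \<alpha> * fst p + \<beta> * snd p \<le> 1 \<and> snd p < fst p} \<in> sets (borel \<Otimes>\<^sub>M borel)"
    by measurable
  have "emeasure lborel {v \<in> D. (v $ 1)\<^sup>2 + (v $ 2)\<^sup>2 < (v $ 3)\<^sup>2 + (v $ 4)\<^sup>2}
     = emeasure (disc_area \<Otimes>\<^sub>M disc_area) {p. \<alpha> * fst p + \<beta> * snd p \<le> 1 \<and> fst p < snd p}"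
    using sets(1) by (subst emeasure_two_planes [symmetric]) (simp_all add: D_def space_pair_measure)
  also have "\<dots> = ennreal (pi\<^sup>2 / (2 * \<beta> * (\<alpha> + \<beta>)))"
    using sets(1) emeasure_disc_area_triangle [OF assms(1,2)]
    by (subst disc_area.emeasure_pair_measure_alt) 
      (simp_all add: space_pair_measure vimage_def cong: sets_pair_measure_cong)
  finally show "measure lborel {v \<in> D. (v $ 1)\<^sup>2 + (v $ 2)\<^sup>2 < (v $ 3)\<^sup>2 + (v $ 4)\<^sup>2} = pi\<^sup>2 / (2 * \<beta> * (\<alpha> + \<beta>))"
    using assms by (simp add: measure_def)
  have "emeasure lborel {v \<in> D. (v $ 3)\<^sup>2 + (v $ 4)\<^sup>2 < (v $ 1)\<^sup>2 + (v $ 2)\<^sup>2}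
     = emeasure (disc_area \<Otimes>\<^sub>M disc_area) {p. \<alpha> * fst p + \<beta> * snd p \<le> 1 \<and> snd p < fst p}"
    using sets(2) by (subst emeasure_two_planes [symmetric]) (simp_all add: D_def space_pair_measure)
  also have "\<dots> = ennreal (pi\<^sup>2 / (2 * \<alpha> * (\<alpha> + \<beta>)))"
    using sets(2) emeasure_disc_area_triangle [OF assms(2,1)]
    by (subst pair.emeasure_pair_measure_alt2) 
      (simp_all add: space_pair_measure vimage_def add.commute cong: sets_pair_measure_cong)
  finally show "measure lborel {v \<in> D. (v $ 3)\<^sup>2 + (v $ 4)\<^sup>2 < (v $ 1)\<^sup>2 + (v $ 2)\<^sup>2} = pi\<^sup>2 / (2 * \<alpha> * (\<alpha> + \<beta>))"
    using assms by (simp add: measure_def)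
qed

section \<open>Splitting cubic forms into their rotation components\<close>

text \<open>
  The first two coordinates parametrize \<^const>\<open>U1\<close>, the products of a linear form with
  \<open>x\<^sup>2 + y\<^sup>2\<close>, on which rotations act by the angle \<open>\<theta>\<close>. The last two parametrize \<^const>\<open>U2\<close>, the
  harmonic cubic forms, on which they act by \<open>3 \<theta>\<close>.
\<close>

definition of_components :: "real^4 \<Rightarrow> real^4" where
  "of_components v = vector [3 * v $ 1 + v $ 3, v $ 2 - v $ 4, v $ 1 - v $ 3, 3 * v $ 2 + v $ 4]"

definition components :: "real^4 \<Rightarrow> real^4" where
  "components u = vector [(u $ 1 + u $ 3) / 4, (u $ 4 + u $ 2) / 4, (u $ 1 - 3 * u $ 3) / 4, (u $ 4 - 3 * u $ 2) / 4]"

lemma of_components_components: "of_components (components u) = u"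
  by (simp add: of_components_def components_def vec_eq_4 vector_4 field_simps)

lemma components_of_components: "components (of_components v) = v"
  by (simp add: of_components_def components_def vec_eq_4 vector_4 field_simps)

lemma linear_of_components: "linear of_components"
  by (rule linearI) (simp_all add: of_components_def vec_eq_4 vector_4 algebra_simps)

text \<open>In these coordinates the sign of \<^const>\<open>T\<close> tells which of the two components is longer.\<close>

lemma T_of_components:
  "T (of_components v) = 2 * (((v $ 1)\<^sup>2 + (v $ 2)\<^sup>2) - ((v $ 3)\<^sup>2 + (v $ 4)\<^sup>2))"
  by (simp add: T_def of_components_def vector_4 power2_eq_square algebra_simps)

lemma r1_components: "r1 u = ((components u $ 1)\<^sup>2 + (components u $ 2)\<^sup>2) / 4"
  by (simp add: r1_def components_def vector_4 power_divide)

lemma r2_components: "r2 u = ((components u $ 3)\<^sup>2 + (components u $ 4)\<^sup>2) / 36"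
  by (simp add: r2_def components_def vector_4 power_divide)

section \<open>Invariant metrics\<close>

lemma quadratic_form_Omega:
  assumes "invariant_metric Q"
  shows "quadratic_form Q (u v* Omega \<theta>) = quadratic_form Q u"
proof -
  have "Q = Omega \<theta> ** Q ** transpose (Omega \<theta>)"
    using assms unfolding invariant_metric_def by blast
  then have "quadratic_form Q u = (u v* (Omega \<theta> ** Q ** transpose (Omega \<theta>))) \<bullet> u"
    unfolding quadratic_form_def
    by (rule arg_cong [of Q "Omega \<theta> ** Q ** transpose (Omega \<theta>)" "\<lambda>M. (u v* M) \<bullet> u"])
  also have "\<dots> = (((u v* Omega \<theta>) v* Q) v* transpose (Omega \<theta>)) \<bullet> u"
    by (simp only: vector_matrix_mul_assoc)
  also have "\<dots> = (Omega \<theta> *v ((u v* Omega \<theta>) v* Q)) \<bullet> u"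
    by (simp only: vector_transpose_matrix)
  also have "\<dots> = quadratic_form Q (u v* Omega \<theta>)"
    unfolding quadratic_form_def by (simp add: inner_commute [of _ u] inner_commute [of "u v* Omega \<theta>"] flip: dot_lmul_matrix)
  finally show ?thesis by simp
qed

lemma quadratic_form_entries:
  assumes "transpose Q = Q"
  shows "quadratic_form Q u = Q$1$1 * (u$1)\<^sup>2 + Q$2$2 * (u$2)\<^sup>2 + Q$3$3 * (u$3)\<^sup>2 + Q$4$4 * (u$4)\<^sup>2
    + 2 * (Q$1$2 * u$1 * u$2 + Q$1$3 * u$1 * u$3 + Q$1$4 * u$1 * u$4
         + Q$2$3 * u$2 * u$3 + Q$2$4 * u$2 * u$4 + Q$3$4 * u$3 * u$4)"
proof -
  have sym: "Q $ i $ j = Q $ j $ i" for i j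
  proof -
    have "transpose Q $ j $ i = Q $ i $ j" by (simp add: transpose_def)
    then show ?thesis by (simp add: assms)
  qed
  show ?thesis
    unfolding quadratic_form_def
    by (simp add: vector_matrix_mult_def inner_vec_def sum_4 sym[of 2 1] sym[of 3 1] sym[of 4 1] sym[of 3 2] sym[of 4 2] sym[of 4 3])
       (simp add: algebra_simps power2_eq_square)
qed

text \<open>This lets the factor \<open>sqrt (det Q)\<close> of both volumes cancel in their ratio.\<close>

lemma positive_definite_det_nonzero:
  assumes "positive_definite Q"
  shows "det Q \<noteq> 0"
proof -
  have "x = 0" if "Q *v x = 0" for x
  proof (rule ccontr)
    assume "x \<noteq> 0"
    then have "0 < quadratic_form Q x"
      using assms by (simp add: positive_definite_def)
    then show False
      by (simp add: quadratic_form_def dot_lmul_matrix that)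
  qed
  then show ?thesis
    by (metis invertible_det_nz invertible_left_inverse matrix_left_invertible_ker)
qed

text \<open>
  The two planes are inequivalent irreducible representations, so they are orthogonal for any
  invariant metric, and on each of them the metric is a multiple of the standard one (Schur).
  Three rotations are enough to see this. The quarter turn acts as a quarter turn on both planes
  and determines the metric on each of them up to scale, but it leaves two parameters for the
  mixed terms. The rotations by \<open>\<plusminus>\<pi>/3\<close> act as \<open>-1\<close> on the second plane but not on the first, which
  forces these parameters to vanish.
\<close>

lemma invariant_metric_components:
  assumes "invariant_metric Q"
  obtains \<alpha> \<beta> where "0 < \<alpha>" "0 < \<beta>"
    "\<And>u. quadratic_form Q u = \<alpha> * ((components u $ 1)\<^sup>2 + (components u $ 2)\<^sup>2)
                           + \<beta> * ((components u $ 3)\<^sup>2 + (components u $ 4)\<^sup>2)"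
proof -
  have "transpose Q = Q" and pos: "\<And>u. u \<noteq> 0 \<Longrightarrow> 0 < quadratic_form Q u"
    using assms by (auto simp: invariant_metric_def positive_definite_def)
  note entries = quadratic_form_entries [OF this(1)]
  have quarter: "u v* Omega (pi/2) = vector [u $ 4, - u $ 3, u $ 2, - u $ 1]" for u
    by (simp add: Omega_def vec_eq_4 vector_4 vector_matrix_mult_def sum_4)
  have turn: "quadratic_form Q (vector [u $ 4, - u $ 3, u $ 2, - u $ 1]) = quadratic_form Q u" for u
    using quadratic_form_Omega [OF assms, of u "pi/2"] by (simp only: quarter)
  have q44: "Q$4$4 = Q$1$1" and q33: "Q$3$3 = Q$2$2" and q14: "Q$1$4 = 0" and q23: "Q$2$3 = 0"
    and q34: "Q$3$4 = - Q$1$2" and q24: "Q$2$4 = Q$1$3"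
    using turn [of "vector [1,0,0,0]"] turn [of "vector [0,1,0,0]"] turn [of "vector [1,0,0,1]"]
      turn [of "vector [0,1,1,0]"] turn [of "vector [1,1,0,0]"] turn [of "vector [1,0,1,0]"]
    by (simp_all add: entries vector_4)
  have sixth: "vector [1,0,0,0] v* Omega (pi/3) = vector [1/8, - sqrt 3/8, 3/8, - 3 * sqrt 3/8]"
    "vector [1,0,0,0] v* Omega (-pi/3) = vector [1/8, sqrt 3/8, 3/8, 3 * sqrt 3/8]"
    by (simp_all add: Omega_def vec_eq_4 vector_4 vector_matrix_mult_def sum_4 sin_60 cos_60
        power3_eq_cube power2_eq_square)
  have "quadratic_form Q (vector [1/8, - sqrt 3/8, 3/8, - 3 * sqrt 3/8]) = Q$1$1"
    "quadratic_form Q (vector [1/8, sqrt 3/8, 3/8, 3 * sqrt 3/8]) = Q$1$1"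
    using quadratic_form_Omega [OF assms, of "vector [1,0,0,0]" "pi/3"]
      quadratic_form_Omega [OF assms, of "vector [1,0,0,0]" "-pi/3"]
    unfolding sixth by (simp_all add: entries vector_4)
  then have "28 * Q$1$1 + 12 * Q$2$2 + 24 * Q$1$3 + 16 * (sqrt 3 * Q$1$2) = 64 * Q$1$1"
    "28 * Q$1$1 + 12 * Q$2$2 + 24 * Q$1$3 - 16 * (sqrt 3 * Q$1$2) = 64 * Q$1$1"
    unfolding entries vector_4 q44 q33 q14 q23 q34 q24
    by (simp_all add: power_divide power_mult_distrib)
  then have q22: "Q$2$2 = 3 * Q$1$1 - 2 * Q$1$3" and "sqrt 3 * Q$1$2 = 0"
    by linarith+
  then have q12: "Q$1$2 = 0"
    by simp
  \<comment> \<open>The values of the metric at \<open>(3, 0, 1, 0)\<close> in \<^const>\<open>U1\<close> and at \<open>(1, 0, -1, 0)\<close> in \<^const>\<open>U2\<close>.\<close>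
  define \<alpha> where "\<alpha> = 12 * Q$1$1 + 4 * Q$1$3"
  define \<beta> where "\<beta> = 4 * Q$1$1 - 4 * Q$1$3"
  have form: "quadratic_form Q u = \<alpha> * ((components u $ 1)\<^sup>2 + (components u $ 2)\<^sup>2)
                           + \<beta> * ((components u $ 3)\<^sup>2 + (components u $ 4)\<^sup>2)" for u
    unfolding entries q44 q33 q14 q23 q34 q24 q22 q12 \<alpha>_def \<beta>_def components_def vector_4
    by (simp add: power_divide) (simp add: power2_eq_square field_simps)
  show thesis
  proof
    show "0 < \<alpha>" using pos [of "vector [3,0,1,0]"] 
      by (simp add: form components_def vector_4 vec_eq_4)
    show "0 < \<beta>" using pos [of "vector [1,0,-1,0]"] 
      by (simp add: form components_def vector_4 vec_eq_4)
  qed (rule form)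
qed

lemma The_normalizing_constant:
  fixes q r :: "'a \<Rightarrow> real"
  assumes "0 < c" "\<And>u. u \<in> U \<Longrightarrow> q u = c * r u" "w \<in> U" "r w \<noteq> 0"
  shows "(THE m. m > 0 \<and> (\<forall>u\<in>U. r u / m\<^sup>2 = q u)) = 1 / sqrt c"
proof (rule the_equality)
  show "1 / sqrt c > 0 \<and> (\<forall>u\<in>U. r u / (1 / sqrt c)\<^sup>2 = q u)"
    using assms(1,2) by (simp add: power_divide)
next
  fix m :: real assume m: "m > 0 \<and> (\<forall>u\<in>U. r u / m\<^sup>2 = q u)"
  then have "r w / m\<^sup>2 = c * r w" using assms by auto
  then have "c = (1 / m)\<^sup>2" using assms(4) m by (simp add: field_simps)
  then show "m = 1 / sqrt c" using m by (simp add: real_sqrt_divide)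
qed

text \<open>
  Since \<^const>\<open>r1\<close> is a quarter and \<^const>\<open>r2\<close> a thirty-sixth of the squared length of the respective
  component, the constants are \<open>m\<^sub>1\<^sup>2 = 1 / (4 \<alpha>)\<close> and \<open>m\<^sub>2\<^sup>2 = 1 / (36 \<beta>)\<close>.
\<close>

lemma asymmetry_square:
  assumes "0 < \<alpha>" "0 < \<beta>"
    and q: "\<And>u. q u = \<alpha> * ((components u $ 1)\<^sup>2 + (components u $ 2)\<^sup>2)
                     + \<beta> * ((components u $ 3)\<^sup>2 + (components u $ 4)\<^sup>2)"
  shows "9 * (asymmetry q)\<^sup>2 = \<alpha> / \<beta>"
proof -
  have "m1 q = 1 / sqrt (4 * \<alpha>)"
    unfolding m1_def
  proof (rule The_normalizing_constant)
    show "q u = 4 * \<alpha> * r1 u" if "u \<in> U1" for u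
      using that by (simp add: q r1_components components_def vector_4 U1_def)
    show "vector [3,0,1,0] \<in> U1" "r1 (vector [3,0,1,0]) \<noteq> 0"
      by (simp_all add: U1_def r1_def vector_4)
  qed (use assms in simp)
  moreover have "m2 q = 1 / sqrt (36 * \<beta>)"
    unfolding m2_def
  proof (rule The_normalizing_constant)
    show "q u = 36 * \<beta> * r2 u" if "u \<in> U2" for u
      using that by (simp add: q r2_components components_def vector_4 U2_def)
    show "vector [1,0,-1,0] \<in> U2" "r2 (vector [1,0,-1,0]) \<noteq> 0"
      by (simp_all add: U2_def r2_def vector_4)
  qed (use assms in simp)
  ultimately show ?thesis
    using assms(1,2) by (simp add: asymmetry_def power_divide)
qed

section \<open>Comparison of the two volumes\<close>

text \<open>
  The coordinates distort all volumes by the same factor, which cancels in a ratio because it is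
  not zero.
\<close>

lemma measure_of_components:
  assumes S: "S \<in> sets borel" "emeasure lborel S < \<infinity>"
  shows "measure lborel (of_components ` S) = \<bar>det (matrix of_components)\<bar> * measure lborel S"
proof -
  have "linear components"
    by (rule linearI) (simp_all add: components_def vec_eq_4 vector_4 field_simps)
  then have [measurable]: "components \<in> borel_measurable borel"
    by (intro borel_measurable_continuous_onI linear_continuous_on linear_conv_bounded_linear[THEN iffD1])
  have "of_components ` S = components -` S"
    by (force simp: components_of_components of_components_components
        intro: image_eqI [where x = "components u" for u])
  then have "of_components ` S \<in> sets borel"
    using measurable_sets_borel[OF _ S(1), of components] by simp
  moreover have "S \<in> lmeasurable" 
    using S by (auto simp: fmeasurable_def)
  ultimately show ?thesis
    using measure_linear_image [OF linear_of_components, of S] S(1)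
    by (simp add: measure_completion)
qed

theorem theorem2:
  fixes Q :: "real^4^4" and q :: "real^4 \<Rightarrow> real"
  assumes "invariant_metric Q"
    and "q = quadratic_form Q"
  shows "metric_volume Q {u \<in> unit_ball q. T u < 0} / metric_volume Q {u \<in> unit_ball q. T u > 0}
           = 9 * (asymmetry q)^2"
proof -
  obtain \<alpha> \<beta> where pos: "0 < \<alpha>" "0 < \<beta>"
    and q: "\<And>u. q u = \<alpha> * ((components u $ 1)\<^sup>2 + (components u $ 2)\<^sup>2)
                     + \<beta> * ((components u $ 3)\<^sup>2 + (components u $ 4)\<^sup>2)"
    using invariant_metric_components assms by metis
  define D where "D = {v :: real^4. \<alpha> * ((v $ 1)\<^sup>2 + (v $ 2)\<^sup>2) + \<beta> * ((v $ 3)\<^sup>2 + (v $ 4)\<^sup>2) \<le> 1}"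
  define Dneg where "Dneg = {v \<in> D. (v $ 1)\<^sup>2 + (v $ 2)\<^sup>2 < (v $ 3)\<^sup>2 + (v $ 4)\<^sup>2}"
  define Dpos where "Dpos = {v \<in> D. (v $ 3)\<^sup>2 + (v $ 4)\<^sup>2 < (v $ 1)\<^sup>2 + (v $ 2)\<^sup>2}"
  have surj: "surj of_components"
    using of_components_components by (rule surjI)
  have "of_components -` {u \<in> unit_ball q. T u < 0} = Dneg"
    "of_components -` {u \<in> unit_ball q. T u > 0} = Dpos"
    by (auto simp: unit_ball_def q components_of_components T_of_components Dneg_def Dpos_def D_def)
  then have neg: "{u \<in> unit_ball q. T u < 0} = of_components ` Dneg"
    and pos': "{u \<in> unit_ball q. T u > 0} = of_components ` Dpos"
    using surj_image_vimage_eq [OF surj] by metis+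
  have meas: "measure lborel Dneg = pi\<^sup>2 / (2 * \<beta> * (\<alpha> + \<beta>))" "measure lborel Dpos = pi\<^sup>2 / (2 * \<alpha> * (\<alpha> + \<beta>))"
    using measure_two_planes_compare [OF pos] by (simp_all add: Dneg_def Dpos_def D_def)
  have sets: "Dneg \<in> sets borel" "Dpos \<in> sets borel"
    unfolding Dneg_def Dpos_def D_def by measurable
  have fin: "emeasure lborel S < \<infinity>" if "measure lborel S > 0" for S :: "(real^4) set"
    using that by (cases "emeasure lborel S") (auto simp: measure_def)
  have finite: "emeasure lborel Dneg < \<infinity>" "emeasure lborel Dpos < \<infinity>"
    using fin [of Dneg] fin [of Dpos] pos by (simp_all add: meas)
  have "det (matrix of_components) \<noteq> 0"
    using det_nz_iff_inj [OF linear_of_components] components_of_components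
    by (metis injI)
  moreover have "det Q \<noteq> 0"
    using assms(1) by (simp add: invariant_metric_def positive_definite_det_nonzero)
  ultimately have "metric_volume Q {u \<in> unit_ball q. T u < 0} / metric_volume Q {u \<in> unit_ball q. T u > 0}
      = measure lborel Dneg / measure lborel Dpos"
    by (simp add: metric_volume_def neg pos' measure_of_components [OF sets(1) finite(1)]
        measure_of_components [OF sets(2) finite(2)])
  also have "\<dots> = \<alpha> / \<beta>"
  proof -
    have "pi\<^sup>2 / (2 * \<beta> * S) / (pi\<^sup>2 / (2 * \<alpha> * S)) = \<alpha> / \<beta>" if "0 < S" for S
      using that pos by (simp add: field_simps)
    then show ?thesis
      unfolding meas using pos by simp
  qed
  also have "\<dots> = 9 * (asymmetry q)\<^sup>2"
    using asymmetry_square [OF pos q] by simp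
  finally show ?thesis .
qed

end
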